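(* Let $B\subseteq[0,1]$ be a band of densities and let $\delta$ be a real number. Suppose $d_{\mathrm{mono}}(W)\le\frac{2}{25}+\delta$ for every triangle-free graphon $W$ whose edge density lies in $B$. Then for every positive integer $n$ and every triangle-free graph $G$ on $N=5n$ vertices whose edge density $2e(G)/N^2$ lies in $B$, $$\beta(G)\le n^2+\frac{25}{2}\,n^2\,\delta .$$ In particular, if $\frac{25}{2}n^2\delta<1$ then $\beta(G)\le n^2$.
   Context: All graphs are finite and simple; $e(G)$ is the number of edges of $G$, and $\beta(G)$ is the minimum number of edges whose deletion makes $G$ bipartite. A graphon is a symmetric measurable function $W:[0,1]^2\to[0,1]$; it is triangle-free if $\int_{[0,1]^3}W(x,y)W(y,z)W(x,z)\,dx\,dy\,dz=0$; its edge density is $\int_{[0,1]^2}W(x,y)\,dx\,dy$. Its monochromatic-pair density is $d_{\mathrm{mono}}(W)=\inf_\varphi\int_{[0,1]^2}W(x,y)\mathbf 1[\varphi(x)=\varphi(y)]\,dx\,dy$, over all measurable $\varphi:[0,1]\to\{0,1\}$. For a finite graph $G$ on $N$ vertices, $W_G$ denotes its step graphon ($N$ equal parts indexed by the vertices, value $1$ on pairs of parts corresponding to edges, $0$ elsewhere); its edge density is $2e(G)/N^2$ and $d_{\mathrm{mono}}(W_G)=2\beta(G)/N^2$. *)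

theory Defs
  imports "HOL-Analysis.Analysis"
begin

section \<open>Finite simple graphs\<close>

text \<open>A graph is given by its vertex set \<open>V\<close> and its set \<open>E\<close> of edges, which are
  two-element subsets of \<open>V\<close>.\<close>

definition simple_graph :: "'a set \<Rightarrow> 'a set set \<Rightarrow> bool" where
  "simple_graph V E \<longleftrightarrow> finite V \<and> (\<forall>e\<in>E. e \<subseteq> V \<and> card e = 2)"

text \<open>In a simple graph, \<open>x\<close>, \<open>y\<close>, \<open>z\<close> below are automatically distinct, as edges have
  exactly two elements.\<close>

definition triangle_free :: "'a set set \<Rightarrow> bool" where
  "triangle_free E \<longleftrightarrow> \<not> (\<exists>x y z. {x, y} \<in> E \<and> {y, z} \<in> E \<and> {x, z} \<in> E)"

definition bipartite :: "'a set \<Rightarrow> 'a set set \<Rightarrow> bool" where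
  "bipartite V E \<longleftrightarrow>
     (\<exists>A B. A \<union> B = V \<and> A \<inter> B = {} \<and> (\<forall>e\<in>E. \<exists>a\<in>A. \<exists>b\<in>B. e = {a, b}))"

text \<open>The quantity written \<open>\<beta>(G)\<close>; the minimum is attained, since \<open>F = E\<close> leaves no edges.\<close>

definition bip_distance :: "'a set \<Rightarrow> 'a set set \<Rightarrow> nat" where
  "bip_distance V E = (LEAST k. \<exists>F\<subseteq>E. card F = k \<and> bipartite V (E - F))"

definition graph_density :: "'a set \<Rightarrow> 'a set set \<Rightarrow> real" where
  "graph_density V E = 2 * real (card E) / (real (card V))\<^sup>2"

section \<open>Graphons\<close>

text \<open>Functions on the unit square are total functions of which only the values on
  \<open>[0,1]\<close> matter: every condition and integral below is restricted to \<open>[0,1]\<close>.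
  Measurability means Borel measurability, for graphons as well as for two-colourings.\<close>

definition graphon :: "(real \<Rightarrow> real \<Rightarrow> real) \<Rightarrow> bool" where
  "graphon W \<longleftrightarrow>
     (\<lambda>(x, y). W x y) \<in> borel_measurable (restrict_space borel ({0..1} \<times> {0..1})) \<and>
     (\<forall>x\<in>{0..1}. \<forall>y\<in>{0..1}. W x y \<in> {0..1} \<and> W x y = W y x)"

definition graphon_triangle_free :: "(real \<Rightarrow> real \<Rightarrow> real) \<Rightarrow> bool" where
  "graphon_triangle_free W \<longleftrightarrow>
     set_lebesgue_integral lborel ({0..1} \<times> {0..1} \<times> {0..1})
       (\<lambda>(x, y, z). W x y * W y z * W x z) = 0"

definition graphon_density :: "(real \<Rightarrow> real \<Rightarrow> real) \<Rightarrow> real" where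
  "graphon_density W = set_lebesgue_integral lborel ({0..1} \<times> {0..1}) (\<lambda>(x, y). W x y)"

definition d_mono :: "(real \<Rightarrow> real \<Rightarrow> real) \<Rightarrow> real" where
  "d_mono W =
     (INF \<phi> \<in> measurable (restrict_space borel {0..1}) (count_space {0, 1 :: nat}).
        set_lebesgue_integral lborel ({0..1} \<times> {0..1})
          (\<lambda>(x, y). W x y * (if \<phi> x = \<phi> y then 1 else 0)))"

end

theory Submission
  imports Defs
begin

text \<open>Take the step graphon of \<open>G\<close>. A two-colouring of \<open>[0,1]\<close> splits the part of vertex \<open>u\<close> in
  some proportion \<open>p u\<close>, and its monochromatic density is a function of \<open>p\<close> that is affine in each
  coordinate because \<open>G\<close> has no loops. Hence the coordinates can be rounded to \<open>0\<close> or \<open>1\<close> one at a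
  time without increasing it, and a \<open>0\<close>-\<open>1\<close> vector is a bipartition of \<open>G\<close>, whose monochromatic
  edges number at least \<open>\<beta>(G)\<close>.\<close>

section \<open>Arcs and bipartitions of a finite graph\<close>

text \<open>Both orientations of each edge are kept, because an edge fills two rectangles of the
  unit square; this is the source of the factor 2 throughout.\<close>

definition arcs :: "'a set set \<Rightarrow> ('a \<times> 'a) set" where
  "arcs E = {(u, v). {u, v} \<in> E}"

lemma arcs_subset:
  assumes "simple_graph V E"
  shows "arcs E \<subseteq> V \<times> V"
  using assms by (fastforce simp: arcs_def simple_graph_def)

lemma finite_arcs:
  assumes "simple_graph V E"
  shows "finite (arcs E)"
  using arcs_subset[OF assms] assms by (meson finite_SigmaI finite_subset simple_graph_def)

lemma arcs_irrefl:
  assumes "simple_graph V E" "(u, v) \<in> arcs E"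
  shows "u \<noteq> v"
  using assms by (force simp: arcs_def simple_graph_def)

lemma card_arcs:
  assumes "simple_graph V E"
  shows "card (arcs E) = 2 * card E"
proof -
  have fin: "finite E"
    using assms by (auto simp: simple_graph_def intro: finite_subset[of E "Pow V"])
  have two: "finite (arcs {e}) \<and> card (arcs {e}) = 2" if e: "e \<in> E" for e
  proof -
    obtain a b where ab: "e = {a, b}" "a \<noteq> b"
      using assms e by (auto simp: simple_graph_def card_2_iff)
    then have "arcs {e} = {(a, b), (b, a)}"
      by (auto simp: arcs_def doubleton_eq_iff)
    then show ?thesis
      using ab by simp
  qed
  have "arcs E = (\<Union>e\<in>E. arcs {e})"
    by (auto simp: arcs_def)
  also have "card \<dots> = (\<Sum>e\<in>E. card (arcs {e}))"
    using fin two by (intro card_UN_disjoint) (auto simp: arcs_def)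
  also have "\<dots> = 2 * card E"
    using two by simp
  finally show ?thesis .
qed

text \<open>Once the edges inside \<open>A\<close> or inside its complement are deleted, every
  remaining edge crosses from \<open>V \<inter> A\<close> to \<open>V - A\<close>, so the deleted
  set competes in the minimum.\<close>

lemma bip_distance_le_mono_edges:
  assumes "simple_graph V E"
  shows "bip_distance V E \<le> card {e \<in> E. e \<subseteq> A \<or> e \<subseteq> - A}"
proof -
  have "bipartite V (E - {e \<in> E. e \<subseteq> A \<or> e \<subseteq> - A})"
    unfolding bipartite_def
  proof (rule exI[of _ "V \<inter> A"], rule exI[of _ "V - A"], intro conjI ballI)
    fix e assume e: "e \<in> E - {e \<in> E. e \<subseteq> A \<or> e \<subseteq> - A}"
    then obtain a b where ab: "e = {a, b}" "a \<in> V" "b \<in> V"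
      using assms unfolding simple_graph_def card_2_iff
      by (metis DiffD1 insert_subset)
    with e consider "a \<in> A" "b \<notin> A" | "b \<in> A" "a \<notin> A"
      by auto
    then show "\<exists>a\<in>V \<inter> A. \<exists>b\<in>V - A. e = {a, b}"
      using ab by cases (auto simp: insert_commute)
  qed auto
  then show ?thesis
    unfolding bip_distance_def
    by (intro Least_le exI[of _ "{e \<in> E. e \<subseteq> A \<or> e \<subseteq> - A}"]) auto
qed

section \<open>Rounding a fractional cut\<close>

text \<open>\<open>F p\<close> is the expected number of monochromatic pairs in \<open>S\<close>
  when each vertex \<open>u\<close> independently gets colour 1 with probability \<open>p u\<close>;
  the rounding is the method of conditional expectations.\<close>

lemma round_to_cut:
  fixes p :: "'a \<Rightarrow> real" and S :: "('a \<times> 'a) set"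
  assumes "finite S" "\<And>u v. (u, v) \<in> S \<Longrightarrow> u \<noteq> v"
    and "finite V" "\<And>u. u \<in> V \<Longrightarrow> p u \<in> {0..1}"
  defines "F \<equiv> \<lambda>p :: 'a \<Rightarrow> real. \<Sum>(u, v)\<in>S. p u * p v + (1 - p u) * (1 - p v)"
  obtains q where "\<And>u. u \<in> V \<Longrightarrow> q u = 0 \<or> q u = 1" "F q \<le> F p"
proof -
  have step: "\<exists>t\<in>{0, 1}. F (p(w := t)) \<le> F p" if "p w \<in> {0..1}" for p w
  proof (rule ccontr)
    assume "\<not> ?thesis"
    then have *: "F p < F (p(w := 0))" "F p < F (p(w := 1))"
      by auto
    \<comment> \<open>No pair of \<open>S\<close> is \<open>(w, w)\<close>, so no square of
      \<open>p w\<close> occurs and \<open>F p\<close> is a convex combination of its two endpoint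
      values.\<close>
    have "F p = p w * F (p(w := 1)) + (1 - p w) * F (p(w := 0))"
      unfolding F_def sum_distrib_left sum.distrib[symmetric]
      by (intro sum.cong refl) (use assms(2) in \<open>auto dest: assms(2) simp: algebra_simps\<close>)
    also have "\<dots> > p w * F p + (1 - p w) * F p"
    \<comment> \<open>Strictness needs an endpoint of positive weight: the endpoint 1 if
      \<open>p w\<close> is nonzero, otherwise the endpoint 0, which then has weight 1.\<close>
    proof (cases "p w = 0")
      case False
      then have "p w * F p < p w * F (p(w := 1))"
        using * that by simp
      moreover have "(1 - p w) * F p \<le> (1 - p w) * F (p(w := 0))"
        using * that by (intro mult_left_mono) auto
      ultimately show ?thesis by linarith
    qed (use * in simp)
    finally show False
      by (simp add: algebra_simps)
  qed
  \<comment> \<open>Agreement with \<open>p\<close> off \<open>V\<close> is what carries the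
    induction: the value \<open>t\<close> already chosen at \<open>w\<close> survives the rounding
    of the other coordinates.\<close>
  have "\<exists>q. (\<forall>u\<in>V. q u = 0 \<or> q u = 1) \<and> (\<forall>u. u \<notin> V \<longrightarrow> q u = p u) \<and> F q \<le> F p"
    using assms(3,4)
  proof (induction V arbitrary: p)
    case (insert w V)
    from insert.prems obtain t where t: "t \<in> {0, 1}" "F (p(w := t)) \<le> F p"
      using step[of p w] by auto
    have "(p(w := t)) u \<in> {0..1}" if "u \<in> V" for u
      using insert.prems[of u] t that by auto
    from insert.IH[OF this] obtain q where q: "(\<forall>u\<in>V. q u = 0 \<or> q u = 1) \<and>
        (\<forall>u. u \<notin> V \<longrightarrow> q u = (p(w := t)) u) \<and> F q \<le> F (p(w := t))"
      by (rule exE)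
    then show ?case
      using t insert.hyps by (intro exI[of _ q]) auto
  qed auto
  then show ?thesis
    by (elim exE conjE) (rule that, auto)
qed

lemma twice_bip_distance_le_fractional_cut:
  fixes p :: "'a \<Rightarrow> real"
  assumes G: "simple_graph V E" and p: "\<And>u. u \<in> V \<Longrightarrow> p u \<in> {0..1}"
  shows "2 * real (bip_distance V E) \<le> (\<Sum>(u, v)\<in>arcs E. p u * p v + (1 - p u) * (1 - p v))"
proof -
  have fin: "finite V"
    using G by (simp add: simple_graph_def)
  obtain q where q: "\<And>u. u \<in> V \<Longrightarrow> q u = 0 \<or> q u = 1"
    and le: "(\<Sum>(u, v)\<in>arcs E. q u * q v + (1 - q u) * (1 - q v))
      \<le> (\<Sum>(u, v)\<in>arcs E. p u * p v + (1 - p u) * (1 - p v))"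
    by (rule round_to_cut[OF finite_arcs[OF G] _ fin, of p]) (erule arcs_irrefl[OF G] p that)+
  define M where "M = {e \<in> E. e \<subseteq> {u. q u = 1} \<or> e \<subseteq> - {u. q u = 1}}"
  have "simple_graph V M"
    using G by (auto simp: simple_graph_def M_def)
  then have "2 * real (card M) = real (card (arcs M))"
    by (simp add: card_arcs)
  also have "\<dots> = (\<Sum>a\<in>arcs E. if a \<in> arcs M then 1 else 0)"
    using finite_arcs[OF G]
    by (simp add: sum.If_cases Int_absorb1 arcs_def M_def subset_eq)
  \<comment> \<open>For values 0 and 1 the summand is 1 if \<open>q u = q v\<close> and 0
    otherwise.\<close>
  also have "\<dots> = (\<Sum>(u, v)\<in>arcs E. q u * q v + (1 - q u) * (1 - q v))"
  proof (intro sum.cong refl, clarify)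
    fix u v assume a: "(u, v) \<in> arcs E"
    then have "u \<in> V" "v \<in> V"
      using arcs_subset[OF G] by auto
    with q[of u] q[of v] a show "(if (u, v) \<in> arcs M then 1 else 0) = q u * q v + (1 - q u) * (1 - q v)"
      by (auto simp: arcs_def M_def)
  qed
  finally show ?thesis
    using le bip_distance_le_mono_edges[OF G, of "{u. q u = 1}"] by (simp add: M_def)
qed

section \<open>Partitions of the unit interval into parts of equal measure\<close>

text \<open>Lying in the unit interval makes both sides of the rectangle finite in measure, which
  gives integrability.\<close>

lemma has_bochner_integral_indicator_Times:
  fixes A B :: "real set"
  assumes "A \<in> sets borel" "B \<in> sets borel" "A \<subseteq> {0..1}" "B \<subseteq> {0..1}"
  shows "has_bochner_integral lborel (indicator (A \<times> B)) (measure lborel A * measure lborel B)"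
proof -
  have fin: "emeasure lborel C < \<infinity>" if "C \<subseteq> {0..1}" for C :: "real set"
    using emeasure_mono[OF that, of lborel] by (simp add: order_le_less_trans)
  have eq: "emeasure lborel (A \<times> B) = emeasure lborel A * emeasure lborel B"
    using lborel.emeasure_pair_measure_Times[of A lborel B] assms by (simp add: lborel_prod)
  then have "measure lborel (A \<times> B) = measure lborel A * measure lborel B"
    by (simp add: measure_def enn2real_mult)
  moreover have "emeasure lborel (A \<times> B) < \<infinity>"
    using eq fin assms by (simp add: ennreal_mult_less_top)
  moreover have "A \<times> B \<in> sets lborel"
    using assms by (simp add: borel_Times)
  ultimately show ?thesis
    using has_bochner_integral_real_indicator[of "A \<times> B" lborel] by simp
qed

text \<open>For nonempty \<open>V\<close>, disjointness and the measures force the parts to cover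
  the unit interval up to a null set.\<close>

locale equipartition =
  fixes V :: "'a set" and I :: "'a \<Rightarrow> real set"
  assumes finite_V: "finite V"
    and borel_part: "\<And>u. u \<in> V \<Longrightarrow> I u \<in> sets borel"
    and part_subset: "\<And>u. u \<in> V \<Longrightarrow> I u \<subseteq> {0..1}"
    and disjoint_parts: "disjoint_family_on I V"
    and measure_part: "\<And>u. u \<in> V \<Longrightarrow> measure lborel (I u) = 1 / card V"

lemma equipartition_exists:
  assumes "finite V"
  obtains I where "equipartition V I"
proof -
  let ?N = "real (card V)"
  obtain f where f: "bij_betw f V {0..<card V}"
    using ex_bij_betw_finite_nat[OF assms] by blast
  \<comment> \<open>Half-open intervals let \<open>f u\<close> be recovered from any point
    \<open>x\<close> of its part as the floor of \<open>?N * x\<close>, whence disjointness. The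
    point 1 lies in no part.\<close>
  define I where "I u = {real (f u) / ?N..<real (f u + 1) / ?N}" for u
  have lt: "f u < card V" if "u \<in> V" for u
    using f that by (auto simp: bij_betw_def)
  have floor: "\<lfloor>?N * x\<rfloor> = f u" if "u \<in> V" "x \<in> I u" for u x
    using that lt[of u] by (intro floor_unique) (auto simp: I_def field_simps)
  have "equipartition V I"
  proof
    show "disjoint_family_on I V"
    proof (unfold disjoint_family_on_def, intro ballI impI)
      fix u v assume uv: "u \<in> V" "v \<in> V" "u \<noteq> v"
      then have "f u \<noteq> f v"
        using f by (auto simp: bij_betw_def inj_on_def)
      then show "I u \<inter> I v = {}"
        using floor[OF uv(1)] floor[OF uv(2)] by force
    qed
    fix u assume u: "u \<in> V"
    have "real (f u) + 1 \<le> ?N"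
      using lt[OF u] by simp
    then have "(real (f u) + 1) / ?N \<le> 1"
      using lt[OF u] by (simp add: divide_le_eq)
    then show "I u \<subseteq> {0..1}"
      by (simp add: I_def atLeastLessThan_subseteq_atLeastAtMost_iff add.commute)
    show "measure lborel (I u) = 1 / card V"
      using lt[OF u] by (simp add: I_def divide_right_mono diff_divide_distrib[symmetric])
  qed (use assms in \<open>auto simp: I_def\<close>)
  then show ?thesis
    using that by blast
qed

section \<open>The step graphon of a graph\<close>

context equipartition
begin

definition step_graphon :: "'a set set \<Rightarrow> real \<Rightarrow> real \<Rightarrow> real" where
  "step_graphon E x y = indicator (\<Union>(u, v)\<in>arcs E. I u \<times> I v) (x, y)"

lemma part_unique:
  "u \<in> V \<Longrightarrow> v \<in> V \<Longrightarrow> x \<in> I u \<Longrightarrow> x \<in> I v \<Longrightarrow> u = v"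
  using disjoint_parts by (auto simp: disjoint_family_on_def)

text \<open>Distinct arcs have disjoint rectangles, since a point determines its part. The sum is
  the form to integrate, the union the form for pointwise arguments.\<close>

lemma step_graphon_eq_sum:
  assumes G: "simple_graph V E"
  shows "step_graphon E x y = (\<Sum>(u, v)\<in>arcs E. indicator (I u \<times> I v) (x, y))"
proof -
  have "disjoint_family_on (\<lambda>(u, v). I u \<times> I v) (arcs E)"
    using arcs_subset[OF G] part_unique by (fastforce simp: disjoint_family_on_def)
  then have "indicator (\<Union>a\<in>arcs E. (\<lambda>(u, v). I u \<times> I v) a) (x, y)
      = (\<Sum>a\<in>arcs E. indicator ((\<lambda>(u, v). I u \<times> I v) a) (x, y) :: real)"
    by (rule indicator_UN_disjoint[OF finite_arcs[OF G]])
  then show ?thesis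
    by (simp add: step_graphon_def case_prod_unfold)
qed

lemma graphon_step_graphon:
  assumes G: "simple_graph V E"
  shows "graphon (step_graphon E)"
  unfolding graphon_def
proof (intro conjI ballI)
  have "(\<Union>(u, v)\<in>arcs E. I u \<times> I v) \<in> sets borel"
    using arcs_subset[OF G] borel_part
    by (intro sets.finite_UN finite_arcs[OF G]) (auto intro!: borel_Times)
  then show "(\<lambda>(x, y). step_graphon E x y) \<in> borel_measurable (restrict_space borel ({0..1} \<times> {0..1}))"
    by (intro measurable_restrict_space1) (simp add: step_graphon_def)
  fix x y
  show "step_graphon E x y \<in> {0..1}"
    by (simp add: step_graphon_def indicator_def)
  show "step_graphon E x y = step_graphon E y x"
    by (simp add: step_graphon_def indicator_def arcs_def) (metis insert_commute)
qed

text \<open>A nonzero product at \<open>x\<close>, \<open>y\<close>, \<open>z\<close> puts the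
  points in parts whose vertices form a triangle, so the integrand vanishes everywhere.\<close>

lemma triangle_free_step_graphon:
  assumes G: "simple_graph V E" and tf: "triangle_free E"
  shows "graphon_triangle_free (step_graphon E)"
proof -
  have "step_graphon E x y * step_graphon E y z * step_graphon E x z = 0" for x y z
  proof (rule ccontr)
    assume "\<not> ?thesis"
    then obtain u v v' w u' w' where *:
      "(u, v) \<in> arcs E" "x \<in> I u" "y \<in> I v" "(v', w) \<in> arcs E" "y \<in> I v'" "z \<in> I w"
      "(u', w') \<in> arcs E" "x \<in> I u'" "z \<in> I w'"
      by (auto simp: step_graphon_def indicator_def split: if_splits)
    then have "v = v'" "u = u'" "w = w'"
      using arcs_subset[OF G] part_unique by blast+
    with * tf show False
      by (auto simp: triangle_free_def arcs_def)
  qed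
  then show ?thesis
    by (simp only: graphon_triangle_free_def set_lebesgue_integral_def case_prod_unfold) simp
qed

text \<open>There are \<open>2 * card E\<close> rectangles, each of area
  \<open>1 / (card V)\<^sup>2\<close>.\<close>

lemma density_step_graphon:
  assumes G: "simple_graph V E"
  shows "graphon_density (step_graphon E) = graph_density V E"
proof -
  have "has_bochner_integral lborel (\<lambda>z. \<Sum>(u, v)\<in>arcs E. indicator (I u \<times> I v) z)
      (\<Sum>(u, v)\<in>arcs E. measure lborel (I u) * measure lborel (I v))"
    unfolding case_prod_unfold using arcs_subset[OF G]
    by (intro has_bochner_integral_sum has_bochner_integral_indicator_Times borel_part part_subset) auto
  also have "(\<Sum>(u, v)\<in>arcs E. measure lborel (I u) * measure lborel (I v))
      = (\<Sum>(u, v)\<in>arcs E. 1 / (real (card V))\<^sup>2)"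
    using arcs_subset[OF G] by (intro sum.cong) (auto simp: measure_part power2_eq_square)
  also have "\<dots> = graph_density V E"
    by (simp add: graph_density_def card_arcs[OF G])
  also have "(\<lambda>z. \<Sum>(u, v)\<in>arcs E. indicator (I u \<times> I v) z)
      = (\<lambda>z. indicator ({0..1} \<times> {0..1}) z *\<^sub>R (case z of (x, y) \<Rightarrow> step_graphon E x y))"
  proof (clarsimp simp: fun_eq_iff)
    fix x y :: real
    show "(\<Sum>(u, v)\<in>arcs E. indicator (I u \<times> I v) (x, y))
      = indicator ({0..1} \<times> {0..1}) (x, y) * step_graphon E x y"
      using arcs_subset[OF G] part_subset unfolding step_graphon_eq_sum[OF G, symmetric]
      by (fastforce simp: step_graphon_def indicator_def)
  qed
  finally show ?thesis
    by (simp add: graphon_density_def set_lebesgue_integral_def has_bochner_integral_integral_eq)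
qed

lemma d_mono_step_graphon_ge:
  assumes G: "simple_graph V E"
  shows "2 * real (bip_distance V E) / (real (card V))\<^sup>2 \<le> d_mono (step_graphon E)"
  unfolding d_mono_def
proof (rule cINF_greatest)
  \<comment> \<open>A lower bound of all members bounds a real infimum only over a nonempty family;
    the constant colouring provides a member.\<close>
  have "(\<lambda>_. 0) \<in> measurable (restrict_space borel {0..1::real}) (count_space {0, 1 :: nat})"
    by simp
  then show "measurable (restrict_space borel {0..1::real}) (count_space {0, 1 :: nat}) \<noteq> {}"
    by blast
  fix \<phi> :: "real \<Rightarrow> nat"
  assume \<phi>: "\<phi> \<in> measurable (restrict_space borel {0..1}) (count_space {0, 1})"
  let ?N = "real (card V)"
  define C where "C k = \<phi> -` {k} \<inter> {0..1}" for k
  \<comment> \<open>The factor \<open>?N\<close> turns the measure of the 1-coloured piece into its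
    share of a part of measure \<open>1 / ?N\<close>.\<close>
  define p where "p u = ?N * measure lborel (I u \<inter> C 1)" for u
  have val: "\<phi> x = 0 \<or> \<phi> x = 1" if "x \<in> {0..1}" for x
    using measurable_space[OF \<phi>, of x] that by (auto simp: space_restrict_space)
  have C: "C k \<in> sets borel" if "k \<in> {0, 1}" for k
    using measurable_sets[OF \<phi>, of "{k}"] that
    by (auto simp: C_def sets_restrict_space_iff space_restrict_space)
  have fin: "emeasure lborel A \<noteq> \<infinity>" if "A \<subseteq> {0..1}" for A :: "real set"
    using emeasure_mono[OF that, of lborel] by (auto simp: top_unique)
  have meas: "measure lborel (I u \<inter> C 1) = p u / ?N" "measure lborel (I u \<inter> C 0) = (1 - p u) / ?N"
    "p u \<in> {0..1}" if u: "u \<in> V" for u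
  proof -
    have N: "?N > 0"
      using u finite_V by (auto simp: card_gt_0_iff)
    have "I u \<subseteq> C 1 \<union> C 0"
      using val subsetD[OF part_subset[OF u]] by (fastforce simp: C_def)
    then have "measure lborel (I u) = measure lborel (I u \<inter> C 1 \<union> I u \<inter> C 0)"
      by (simp add: Int_Un_distrib[symmetric] Int_absorb2)
    also have "\<dots> = measure lborel (I u \<inter> C 1) + measure lborel (I u \<inter> C 0)"
      using C borel_part[OF u] part_subset[OF u]
      by (intro measure_Union fin) (auto simp: C_def)
    finally have sum: "measure lborel (I u \<inter> C 1) + measure lborel (I u \<inter> C 0) = 1 / ?N"
      using measure_part[OF u] by simp
    show 1: "measure lborel (I u \<inter> C 1) = p u / ?N"
      using N by (simp add: p_def)
    show 0: "measure lborel (I u \<inter> C 0) = (1 - p u) / ?N"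
      using sum 1 by (simp add: diff_divide_distrib)
    show "p u \<in> {0..1}"
      using N measure_nonneg[of lborel "I u \<inter> C 1"] measure_nonneg[of lborel "I u \<inter> C 0"]
      unfolding 0 1 by (simp add: zero_le_divide_iff)
  qed
  \<comment> \<open>The monochromatic points of \<open>I u \<times> I v\<close> form two rectangles,
    one for each colour.\<close>
  let ?f = "\<lambda>z. \<Sum>(u, v)\<in>arcs E. indicator ((I u \<inter> C 1) \<times> (I v \<inter> C 1)) z
    + indicator ((I u \<inter> C 0) \<times> (I v \<inter> C 0)) z :: real"
  have "2 * real (bip_distance V E) / ?N\<^sup>2
      \<le> (\<Sum>(u, v)\<in>arcs E. p u * p v + (1 - p u) * (1 - p v)) / ?N\<^sup>2"
    using meas(3) by (intro divide_right_mono twice_bip_distance_le_fractional_cut[OF G]) auto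
  also have "\<dots> = (\<Sum>(u, v)\<in>arcs E. measure lborel (I u \<inter> C 1) * measure lborel (I v \<inter> C 1)
      + measure lborel (I u \<inter> C 0) * measure lborel (I v \<inter> C 0))"
    unfolding sum_divide_distrib using arcs_subset[OF G]
    by (intro sum.cong) (auto simp: meas(1,2) power2_eq_square add_divide_distrib simp del: One_nat_def)
  also have "\<dots> = integral\<^sup>L lborel ?f"
  proof (rule has_bochner_integral_integral_eq[symmetric])
    have rect: "has_bochner_integral lborel (indicator ((I u \<inter> C k) \<times> (I v \<inter> C k)))
        (measure lborel (I u \<inter> C k) * measure lborel (I v \<inter> C k))"
      if "(u, v) \<in> arcs E" "k \<in> {0, 1}" for u v k
    proof -
      have "u \<in> V" "v \<in> V"
        using that arcs_subset[OF G] by auto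
      then show ?thesis
        using that(2) by (intro has_bochner_integral_indicator_Times sets.Int borel_part C)
          (auto simp: C_def)
    qed
    show "has_bochner_integral lborel ?f
      (\<Sum>(u, v)\<in>arcs E. measure lborel (I u \<inter> C 1) * measure lborel (I v \<inter> C 1)
        + measure lborel (I u \<inter> C 0) * measure lborel (I v \<inter> C 0))"
      unfolding case_prod_unfold
      by (intro has_bochner_integral_sum has_bochner_integral_add rect) auto
  qed
  also have "?f = (\<lambda>z. indicator ({0..1} \<times> {0..1}) z *\<^sub>R
      (case z of (x, y) \<Rightarrow> step_graphon E x y * (if \<phi> x = \<phi> y then 1 else 0)))"
  proof
    fix z :: "real \<times> real"
    obtain x y where z: "z = (x, y)"
      by fastforce
    have "?f (x, y) = (\<Sum>(u, v)\<in>arcs E. indicator (I u \<times> I v) (x, y)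
        * (indicator ({0..1} \<times> {0..1}) (x, y) * (if \<phi> x = \<phi> y then 1 else 0)))"
    proof (intro sum.cong refl, clarify)
      fix u v
      show "indicator ((I u \<inter> C 1) \<times> (I v \<inter> C 1)) (x, y)
          + indicator ((I u \<inter> C 0) \<times> (I v \<inter> C 0)) (x, y)
        = (indicator (I u \<times> I v) (x, y)
          * (indicator ({0..1} \<times> {0..1}) (x, y) * (if \<phi> x = \<phi> y then 1 else 0)) :: real)"
      \<comment> \<open>Outside the unit square \<open>\<phi>\<close> is unconstrained, but both
        sides are 0 there because each \<open>C k\<close> is cut down to the unit interval.\<close>
      proof (cases "x \<in> {0..1} \<and> y \<in> {0..1}")
        case True
        then have "\<phi> x = 0 \<or> \<phi> x = 1" "\<phi> y = 0 \<or> \<phi> y = 1"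
          using val by blast+
        with True show ?thesis
          by (elim disjE) (simp_all add: C_def indicator_def)
      qed (auto simp: C_def)
    qed
    also have "\<dots> = indicator ({0..1} \<times> {0..1}) (x, y) *
        (step_graphon E x y * (if \<phi> x = \<phi> y then 1 else 0))"
      unfolding step_graphon_eq_sum[OF G] case_prod_unfold sum_distrib_right[symmetric] by simp
    finally show "?f z = indicator ({0..1} \<times> {0..1}) z *\<^sub>R
      (case z of (x, y) \<Rightarrow> step_graphon E x y * (if \<phi> x = \<phi> y then 1 else 0))"
      by (simp add: z)
  qed
  finally show "2 * real (bip_distance V E) / ?N\<^sup>2
    \<le> set_lebesgue_integral lborel ({0..1} \<times> {0..1})
        (\<lambda>(x, y). step_graphon E x y * (if \<phi> x = \<phi> y then 1 else 0))"
    by (simp add: set_lebesgue_integral_def)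
qed

end

section \<open>The bound for graphs on \<open>5 * n\<close> vertices\<close>

theorem proposition2p2:
  fixes B :: "real set" and \<delta> :: real and n :: nat
    and V :: "'a set" and E :: "'a set set"
  assumes "B \<subseteq> {0..1}"
    and "\<And>W. graphon W \<Longrightarrow> graphon_triangle_free W \<Longrightarrow> graphon_density W \<in> B \<Longrightarrow>
           d_mono W \<le> 2 / 25 + \<delta>"
    and "n > 0"
    and "simple_graph V E"
    and "card V = 5 * n"
    and "triangle_free E"
    and "graph_density V E \<in> B"
  shows "real (bip_distance V E) \<le> (real n)\<^sup>2 + 25 / 2 * (real n)\<^sup>2 * \<delta> \<and>
         (25 / 2 * (real n)\<^sup>2 * \<delta> < 1 \<longrightarrow> bip_distance V E \<le> n\<^sup>2)"
proof -
  have "finite V"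
    using assms(4) by (simp add: simple_graph_def)
  then obtain I where "equipartition V I"
    by (rule equipartition_exists)
  then interpret equipartition V I .
  have "2 * real (bip_distance V E) / (real (card V))\<^sup>2 \<le> d_mono (step_graphon E)"
    by (rule d_mono_step_graphon_ge[OF assms(4)])
  also have "\<dots> \<le> 2 / 25 + \<delta>"
    using assms(4,6,7) by (intro assms(2) graphon_step_graphon triangle_free_step_graphon)
      (simp_all add: density_step_graphon)
  \<comment> \<open>Multiplying by half of \<open>(5 * n)\<^sup>2\<close>, that is by
    \<open>25 / 2 * n\<^sup>2\<close>, turns \<open>2 / 25\<close> into exactly
    \<open>n\<^sup>2\<close>.\<close>
  finally have bound: "real (bip_distance V E) \<le> (real n)\<^sup>2 + 25 / 2 * (real n)\<^sup>2 * \<delta>"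
    using assms(3,5) by (simp add: field_simps)
  moreover have "bip_distance V E \<le> n\<^sup>2" if "25 / 2 * (real n)\<^sup>2 * \<delta> < 1"
  proof -
    \<comment> \<open>An integer below \<open>n\<^sup>2 + 1\<close> is at most
      \<open>n\<^sup>2\<close>.\<close>
    have "real (bip_distance V E) < real (n\<^sup>2 + 1)"
      using bound that by simp
    then show ?thesis
      by linarith
  qed
  ultimately show ?thesis
    by blast
qed

end
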